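(* Let $(A,\cdot,\alpha,\beta)$ be a BiHom-alternative algebra over a field $\mathbb{K}$ of characteristic $0$, $(V,\ell,r,\phi,\psi)$ a bimodule of $A$, and $\theta:A\times A\to V$ a bilinear map. Define on $A\oplus V$ the product $$(x+u)\circ(y+v)=xy+\ell(x)v+r(y)u+\theta(x,y),\qquad x,y\in A,\ u,v\in V.$$ Then $(A\oplus V,\circ,\alpha+\phi,\beta+\psi)$ is a BiHom-alternative algebra if and only if the following hold for all $x,y,z\in A$: (1) $\phi\theta(x,y)=\theta(\alpha(x),\alpha(y))$ and $\psi\theta(x,y)=\theta(\beta(x),\beta(y))$; (2) $\theta(\beta(x)\alpha(y),\beta(z))+r(\beta(z))\theta(\beta(x),\alpha(y))-\theta(\alpha\beta(x),\alpha(y)z)-\ell(\alpha\beta(x))\theta(\alpha(y),z)$ $+\theta(\beta(y)\alpha(x),\beta(z))+r(\beta(z))\theta(\beta(y),\alpha(x))-\theta(\alpha\beta(y),\alpha(x)z)-\ell(\alpha\beta(y))\theta(\alpha(x),z)=0$; (3) $\theta(x\beta(y),\alpha\beta(z))+r(\alpha\beta(z))\theta(x,\beta(y))-\theta(\alpha(x),\beta(y)\alpha(z))-\ell(\alpha(x))\theta(\beta(y),\alpha(z))$ $+\theta(x\beta(z),\alpha\beta(y))+r(\alpha\beta(y))\theta(x,\beta(z))-\theta(\alpha(x),\beta(z)\alpha(y))-\ell(\alpha(x))\theta(\beta(z),\alpha(y))=0$.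
   Context: The product of $A$ is written by concatenation. A BiHom-alternative algebra $(A,\mu,\alpha,\beta)$ is a $\mathbb{K}$-vector space $A$ with a bilinear product $\mu(x,y)=xy$ and linear maps $\alpha,\beta:A\to A$ such that $\alpha\beta=\beta\alpha$, $\alpha(xy)=\alpha(x)\alpha(y)$, $\beta(xy)=\beta(x)\beta(y)$, and for all $x,y,z\in A$ $$as_{\alpha,\beta}(\beta(x),\alpha(y),z)+as_{\alpha,\beta}(\beta(y),\alpha(x),z)=0,\qquad as_{\alpha,\beta}(x,\beta(y),\alpha(z))+as_{\alpha,\beta}(x,\beta(z),\alpha(y))=0,$$ where $as_{\alpha,\beta}(x,y,z)=(xy)\beta(z)-\alpha(x)(yz)$. A bimodule (representation) $(V,\ell,r,\phi,\psi)$ consists of a vector space $V$, linear maps $\ell,r:A\to gl(V)$ (linear endomorphisms of $V$) and two commuting linear maps $\phi,\psi\in gl(V)$ such that for all $x,y\in A$, $v\in V$: (i) $\phi\ell(x)=\ell(\alpha(x))\phi$, $\phi r(x)=r(\alpha(x))\phi$, $\psi\ell(x)=\ell(\beta(x))\psi$, $\psi r(x)=r(\beta(x))\psi$; (ii) $\ell(\beta(x)\alpha(x))\psi(v)=\ell(\alpha\beta(x))\ell(\alpha(x))v$; (iii) $r(\beta(x)\alpha(x))\phi(v)=r(\alpha\beta(x))r(\beta(x))v$; (iv) $r(\beta(y))\ell(\beta(x))\phi(v)-\ell(\alpha\beta(x))r(y)\phi(v)=r(\alpha(x)y)\phi\psi(v)-r(\beta(y))r(\alpha(x))\psi(v)$;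 (v) $\ell(\alpha(y))r(\alpha(x))\psi(v)-r(\alpha\beta(x))\ell(y)\psi(v)=\ell(y\beta(x))\phi\psi(v)-\ell(\alpha(y))\ell(\beta(x))\phi(v)$. The maps on $A\oplus V$ are $(\alpha+\phi)(x+v)=\alpha(x)+\phi(v)$ and $(\beta+\psi)(x+v)=\beta(x)+\psi(v)$. *)

theory Defs
  imports "HOL-Analysis.Product_Vector"
begin

text \<open>
  A vector space is a type of class \<^class>\<open>ab_group_add\<close> together with an explicit scalar
  multiplication by a field \<open>'k\<close> (locale \<^locale>\<open>vector_space\<close>), so that one ground field acts on
  both the algebra and the module.
\<close>

definition bilinear_map ::
  "('k::field \<Rightarrow> 'a::ab_group_add \<Rightarrow> 'a) \<Rightarrow> ('k \<Rightarrow> 'b::ab_group_add \<Rightarrow> 'b) \<Rightarrow>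
   ('k \<Rightarrow> 'c::ab_group_add \<Rightarrow> 'c) \<Rightarrow> ('a \<Rightarrow> 'b \<Rightarrow> 'c) \<Rightarrow> bool" where
  "bilinear_map s1 s2 s3 f \<longleftrightarrow>
     (\<forall>x. Vector_Spaces.linear s2 s3 (\<lambda>y. f x y)) \<and>
     (\<forall>y. Vector_Spaces.linear s1 s3 (\<lambda>x. f x y))"

definition bihom_associator ::
  "('a::ab_group_add \<Rightarrow> 'a \<Rightarrow> 'a) \<Rightarrow> ('a \<Rightarrow> 'a) \<Rightarrow> ('a \<Rightarrow> 'a) \<Rightarrow> 'a \<Rightarrow> 'a \<Rightarrow> 'a \<Rightarrow> 'a" where
  "bihom_associator mul \<alpha> \<beta> x y z = mul (mul x y) (\<beta> z) - mul (\<alpha> x) (mul y z)"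

locale bihom_alternative_algebra = vector_space scale
  for scale :: "'k::field \<Rightarrow> 'a::ab_group_add \<Rightarrow> 'a" +
  fixes mul :: "'a \<Rightarrow> 'a \<Rightarrow> 'a" (infixl "\<cdot>" 70)
    and \<alpha> \<beta> :: "'a \<Rightarrow> 'a"
  assumes mul_bilinear: "bilinear_map scale scale scale (\<cdot>)"
    and alpha_linear: "Vector_Spaces.linear scale scale \<alpha>"
    and beta_linear: "Vector_Spaces.linear scale scale \<beta>"
    and alpha_beta_commute: "\<alpha> \<circ> \<beta> = \<beta> \<circ> \<alpha>"
    and alpha_mul: "\<alpha> (x \<cdot> y) = \<alpha> x \<cdot> \<alpha> y"
    and beta_mul: "\<beta> (x \<cdot> y) = \<beta> x \<cdot> \<beta> y"
    and left_alternative: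
      "bihom_associator (\<cdot>) \<alpha> \<beta> (\<beta> x) (\<alpha> y) z + bihom_associator (\<cdot>) \<alpha> \<beta> (\<beta> y) (\<alpha> x) z = 0"
    and right_alternative:
      "bihom_associator (\<cdot>) \<alpha> \<beta> x (\<beta> y) (\<alpha> z) + bihom_associator (\<cdot>) \<alpha> \<beta> x (\<beta> z) (\<alpha> y) = 0"

text \<open>
  \<open>gl(V)\<close> denotes all linear endomorphisms of \<open>V\<close>, with pointwise operations. Hence a linear map
  \<open>l : A \<rightarrow> gl(V)\<close> is a curried function that is linear in each of its two arguments.
\<close>

locale bihom_alternative_bimodule =
  A: bihom_alternative_algebra scaleA mul \<alpha> \<beta> + V: vector_space scaleV
  for scaleA :: "'k::field \<Rightarrow> 'a::ab_group_add \<Rightarrow> 'a"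
    and mul :: "'a \<Rightarrow> 'a \<Rightarrow> 'a" (infixl "\<cdot>" 70)
    and \<alpha> \<beta> :: "'a \<Rightarrow> 'a"
    and scaleV :: "'k \<Rightarrow> 'v::ab_group_add \<Rightarrow> 'v" +
  fixes l r :: "'a \<Rightarrow> 'v \<Rightarrow> 'v"
    and \<phi> \<psi> :: "'v \<Rightarrow> 'v"
  assumes l_linear: "bilinear_map scaleA scaleV scaleV l"
    and r_linear: "bilinear_map scaleA scaleV scaleV r"
    and phi_linear: "Vector_Spaces.linear scaleV scaleV \<phi>"
    and psi_linear: "Vector_Spaces.linear scaleV scaleV \<psi>"
    and phi_psi_commute: "\<phi> \<circ> \<psi> = \<psi> \<circ> \<phi>"
    and phi_l: "\<phi> \<circ> l x = l (\<alpha> x) \<circ> \<phi>"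
    and phi_r: "\<phi> \<circ> r x = r (\<alpha> x) \<circ> \<phi>"
    and psi_l: "\<psi> \<circ> l x = l (\<beta> x) \<circ> \<psi>"
    and psi_r: "\<psi> \<circ> r x = r (\<beta> x) \<circ> \<psi>"
    and l_alternative: "l (\<beta> x \<cdot> \<alpha> x) (\<psi> v) = l (\<alpha> (\<beta> x)) (l (\<alpha> x) v)"
    and r_alternative: "r (\<beta> x \<cdot> \<alpha> x) (\<phi> v) = r (\<alpha> (\<beta> x)) (r (\<beta> x) v)"
    and mixed_left:
      "r (\<beta> y) (l (\<beta> x) (\<phi> v)) - l (\<alpha> (\<beta> x)) (r y (\<phi> v)) =
       r (\<alpha> x \<cdot> y) (\<phi> (\<psi> v)) - r (\<beta> y) (r (\<alpha> x) (\<psi> v))"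
    and mixed_right:
      "l (\<alpha> y) (r (\<alpha> x) (\<psi> v)) - r (\<alpha> (\<beta> x)) (l y (\<psi> v)) =
       l (y \<cdot> \<beta> x) (\<phi> (\<psi> v)) - l (\<alpha> y) (l (\<beta> x) (\<phi> v))"

text \<open>
  The direct sum \<open>A \<oplus> V\<close> is the product type, an element \<open>x + u\<close> being the pair \<open>(x, u)\<close>; its
  scalar multiplication is \<^const>\<open>module_prod.scale\<close> and \<open>\<alpha> + \<phi>\<close> is \<^const>\<open>map_prod\<close>.
\<close>

definition extension_mul ::
  "('a \<Rightarrow> 'a \<Rightarrow> 'a) \<Rightarrow> ('a \<Rightarrow> 'v::ab_group_add \<Rightarrow> 'v) \<Rightarrow> ('a \<Rightarrow> 'v \<Rightarrow> 'v) \<Rightarrow> ('a \<Rightarrow> 'a \<Rightarrow> 'v) \<Rightarrow>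
   'a \<times> 'v \<Rightarrow> 'a \<times> 'v \<Rightarrow> 'a \<times> 'v" where
  "extension_mul mul l r \<theta> = (\<lambda>(x, u) (y, v). (mul x y, l x v + r y u + \<theta> x y))"

end

theory Submission
  imports Defs
begin

text \<open>
  The \<open>V\<close>-component of each alternativity identity for \<open>A \<oplus> V\<close> is the \<open>\<theta>\<close>-expression of the
  statement plus terms linear in \<open>u\<close>, \<open>v\<close>, \<open>w\<close>. The latter vanish by the bimodule axioms (iv) and (v)
  and by the polarizations of (ii) and (iii).
\<close>

text \<open>Flattening the nested linearity predicates into equations lets the rewrite rules for the
  product, \<open>l\<close>, \<open>r\<close> and \<open>\<theta>\<close> be read off directly.
  Bilinearity on the direct sum is checked in the same form.\<close>

lemma bilinear_map_iff:
  "bilinear_map s1 s2 s3 f \<longleftrightarrow>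
     vector_space s1 \<and> vector_space s2 \<and> vector_space s3 \<and>
     (\<forall>x y y'. f x (y + y') = f x y + f x y') \<and> (\<forall>x x' y. f (x + x') y = f x y + f x' y) \<and>
     (\<forall>c x y. f x (s2 c y) = s3 c (f x y)) \<and> (\<forall>c x y. f (s1 c x) y = s3 c (f x y))"
  unfolding bilinear_map_def Vector_Spaces.linear_iff by blast

context bihom_alternative_bimodule
begin

sublocale prod: vector_space_prod scaleA scaleV ..

lemma alpha_add: "\<alpha> (x + y) = \<alpha> x + \<alpha> y"
  and alpha_scale: "\<alpha> (scaleA c x) = scaleA c (\<alpha> x)"
  using A.alpha_linear unfolding Vector_Spaces.linear_iff by blast+

lemma beta_add: "\<beta> (x + y) = \<beta> x + \<beta> y"
  and beta_scale: "\<beta> (scaleA c x) = scaleA c (\<beta> x)"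
  using A.beta_linear unfolding Vector_Spaces.linear_iff by blast+

lemma phi_add: "\<phi> (u + v) = \<phi> u + \<phi> v"
  and phi_scale: "\<phi> (scaleV c u) = scaleV c (\<phi> u)"
  using phi_linear unfolding Vector_Spaces.linear_iff by blast+

lemma psi_add: "\<psi> (u + v) = \<psi> u + \<psi> v"
  and psi_scale: "\<psi> (scaleV c u) = scaleV c (\<psi> u)"
  using psi_linear unfolding Vector_Spaces.linear_iff by blast+

lemma mul_add_left: "(x + x') \<cdot> y = x \<cdot> y + x' \<cdot> y"
  and mul_add_right: "x \<cdot> (y + y') = x \<cdot> y + x \<cdot> y'"
  and mul_scale_left: "scaleA c x \<cdot> y = scaleA c (x \<cdot> y)"
  and mul_scale_right: "x \<cdot> scaleA c y = scaleA c (x \<cdot> y)"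
  using A.mul_bilinear unfolding bilinear_map_iff by blast+

lemma l_add_left: "l (x + x') v = l x v + l x' v"
  and l_add_right: "l x (v + v') = l x v + l x v'"
  and l_scale_left: "l (scaleA c x) v = scaleV c (l x v)"
  and l_scale_right: "l x (scaleV c v) = scaleV c (l x v)"
  using l_linear unfolding bilinear_map_iff by blast+

lemma r_add_left: "r (x + x') v = r x v + r x' v"
  and r_add_right: "r x (v + v') = r x v + r x v'"
  and r_scale_left: "r (scaleA c x) v = scaleV c (r x v)"
  and r_scale_right: "r x (scaleV c v) = scaleV c (r x v)"
  using r_linear unfolding bilinear_map_iff by blast+

lemmas add_simps = alpha_add beta_add phi_add psi_add mul_add_left mul_add_right
  l_add_left l_add_right r_add_left r_add_right

lemmas scale_simps = alpha_scale beta_scale phi_scale psi_scale mul_scale_left mul_scale_right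
  l_scale_left l_scale_right r_scale_left r_scale_right

lemma beta_alpha: "\<beta> (\<alpha> x) = \<alpha> (\<beta> x)"
  using A.alpha_beta_commute by (metis comp_apply)

lemma psi_phi: "\<psi> (\<phi> v) = \<phi> (\<psi> v)"
  using phi_psi_commute by (metis comp_apply)

text \<open>Put \<open>x + y\<close> for \<open>x\<close> in \<open>l_alternative\<close> and cancel
  the instances at \<open>x\<close> and at \<open>y\<close>; the cross terms remain. This is the
  form that occurs when an associator is added to its copy with \<open>x\<close> and
  \<open>y\<close> exchanged.\<close>

lemma l_alternative_polarized:
  "l (\<beta> x \<cdot> \<alpha> y) (\<psi> v) + l (\<beta> y \<cdot> \<alpha> x) (\<psi> v) =
   l (\<alpha> (\<beta> x)) (l (\<alpha> y) v) + l (\<alpha> (\<beta> y)) (l (\<alpha> x) v)"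
  using l_alternative[of "x + y" v] l_alternative[of x v] l_alternative[of y v]
  by (simp add: add_simps algebra_simps)

lemma r_alternative_polarized:
  "r (\<beta> x \<cdot> \<alpha> y) (\<phi> v) + r (\<beta> y \<cdot> \<alpha> x) (\<phi> v) =
   r (\<alpha> (\<beta> x)) (r (\<beta> y) v) + r (\<alpha> (\<beta> y)) (r (\<beta> x) v)"
  using r_alternative[of "x + y" v] r_alternative[of x v] r_alternative[of y v]
  by (simp add: add_simps algebra_simps)

end

text \<open>The inherited parameters get fresh type variables: \<open>'b\<close> is the type of the
  algebra, \<open>'c\<close> that of the module.\<close>

locale bihom_alternative_extension = bihom_alternative_bimodule +
  fixes \<theta> :: "'b \<Rightarrow> 'b \<Rightarrow> 'c"
  assumes theta_bilinear: "bilinear_map scaleA scaleA scaleV \<theta>"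
begin

abbreviation ext_mul (infixl "\<circ>\<^sub>\<theta>" 70)
  where "(\<circ>\<^sub>\<theta>) \<equiv> extension_mul (\<cdot>) l r \<theta>"

abbreviation "ext_assoc \<equiv> bihom_associator (\<circ>\<^sub>\<theta>) (map_prod \<alpha> \<phi>) (map_prod \<beta> \<psi>)"

text \<open>The part of the left alternator of the direct sum that involves only
  \<open>\<theta>\<close>: its vanishing is the cocycle condition on \<open>\<theta>\<close> for
  left alternativity.\<close>

definition left_cocycle :: "'b \<Rightarrow> 'b \<Rightarrow> 'b \<Rightarrow> 'c" where
  "left_cocycle x y z =
     \<theta> (\<beta> x \<cdot> \<alpha> y) (\<beta> z) + r (\<beta> z) (\<theta> (\<beta> x) (\<alpha> y))
   - \<theta> (\<alpha> (\<beta> x)) (\<alpha> y \<cdot> z) - l (\<alpha> (\<beta> x)) (\<theta> (\<alpha> y) z)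
   + \<theta> (\<beta> y \<cdot> \<alpha> x) (\<beta> z) + r (\<beta> z) (\<theta> (\<beta> y) (\<alpha> x))
   - \<theta> (\<alpha> (\<beta> y)) (\<alpha> x \<cdot> z) - l (\<alpha> (\<beta> y)) (\<theta> (\<alpha> x) z)"

definition right_cocycle :: "'b \<Rightarrow> 'b \<Rightarrow> 'b \<Rightarrow> 'c" where
  "right_cocycle x y z =
     \<theta> (x \<cdot> \<beta> y) (\<alpha> (\<beta> z)) + r (\<alpha> (\<beta> z)) (\<theta> x (\<beta> y))
   - \<theta> (\<alpha> x) (\<beta> y \<cdot> \<alpha> z) - l (\<alpha> x) (\<theta> (\<beta> y) (\<alpha> z))
   + \<theta> (x \<cdot> \<beta> z) (\<alpha> (\<beta> y)) + r (\<alpha> (\<beta> y)) (\<theta> x (\<beta> z))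
   - \<theta> (\<alpha> x) (\<beta> z \<cdot> \<alpha> y) - l (\<alpha> x) (\<theta> (\<beta> z) (\<alpha> y))"

lemma theta_add_left: "\<theta> (x + x') y = \<theta> x y + \<theta> x' y"
  and theta_add_right: "\<theta> x (y + y') = \<theta> x y + \<theta> x y'"
  and theta_scale_left: "\<theta> (scaleA c x) y = scaleV c (\<theta> x y)"
  and theta_scale_right: "\<theta> x (scaleA c y) = scaleV c (\<theta> x y)"
  using theta_bilinear unfolding bilinear_map_iff by blast+

lemma ext_mul_simp: "(x, u) \<circ>\<^sub>\<theta> (y, v) = (x \<cdot> y, l x v + r y u + \<theta> x y)"
  by (simp add: extension_mul_def)

text \<open>Each of the three summands in the module component is bilinear in the two pairs, so this
  imposes no further condition on \<open>\<theta>\<close>.\<close>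

lemma ext_mul_bilinear:
  "bilinear_map (module_prod.scale scaleA scaleV) (module_prod.scale scaleA scaleV)
     (module_prod.scale scaleA scaleV) (\<circ>\<^sub>\<theta>)"
  unfolding bilinear_map_iff
  by (auto simp: prod.p.vector_space_axioms ext_mul_simp prod.scale_prod add_simps scale_simps
      theta_add_left theta_add_right theta_scale_left theta_scale_right
      V.scale_right_distrib algebra_simps)

lemma map_prod_linear:
  "Vector_Spaces.linear (module_prod.scale scaleA scaleV) (module_prod.scale scaleA scaleV)
     (map_prod \<alpha> \<phi>)"
  "Vector_Spaces.linear (module_prod.scale scaleA scaleV) (module_prod.scale scaleA scaleV)
     (map_prod \<beta> \<psi>)"
  unfolding Vector_Spaces.linear_iff
  by (auto simp: prod.p.vector_space_axioms prod.scale_prod add_simps scale_simps)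

lemma map_prod_commute: "map_prod \<alpha> \<phi> \<circ> map_prod \<beta> \<psi> = map_prod \<beta> \<psi> \<circ> map_prod \<alpha> \<phi>"
  by (simp add: map_prod.comp A.alpha_beta_commute phi_psi_commute)

text \<open>The algebra components agree since \<open>\<alpha>\<close> is multiplicative. In the
  module components \<open>phi_l\<close> and \<open>phi_r\<close> match the terms in
  \<open>u\<close> and \<open>v\<close>, which cancel and leave a condition on
  \<open>\<theta>\<close> alone.\<close>

lemma map_prod_alpha_mul_iff:
  "map_prod \<alpha> \<phi> ((x, u) \<circ>\<^sub>\<theta> (y, v)) = map_prod \<alpha> \<phi> (x, u) \<circ>\<^sub>\<theta> map_prod \<alpha> \<phi> (y, v) \<longleftrightarrow>
   \<phi> (\<theta> x y) = \<theta> (\<alpha> x) (\<alpha> y)"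
  using phi_l[of x] phi_r[of y]
  by (simp add: ext_mul_simp A.alpha_mul add_simps fun_eq_iff)

lemma map_prod_beta_mul_iff:
  "map_prod \<beta> \<psi> ((x, u) \<circ>\<^sub>\<theta> (y, v)) = map_prod \<beta> \<psi> (x, u) \<circ>\<^sub>\<theta> map_prod \<beta> \<psi> (y, v) \<longleftrightarrow>
   \<psi> (\<theta> x y) = \<theta> (\<beta> x) (\<beta> y)"
  using psi_l[of x] psi_r[of y]
  by (simp add: ext_mul_simp A.beta_mul add_simps fun_eq_iff)

lemma ext_left_alternator:
  "ext_assoc (map_prod \<beta> \<psi> (x, u)) (map_prod \<alpha> \<phi> (y, v)) (z, w) +
   ext_assoc (map_prod \<beta> \<psi> (y, v)) (map_prod \<alpha> \<phi> (x, u)) (z, w) = (0, left_cocycle x y z)"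
proof -
  \<comment> \<open>These are all the terms in one module variable \<open>v\<close>: those with
    \<open>l\<close> come from the associator having \<open>v\<close> in the middle slot, the other
    two from the one having it in the first slot. Axiom (iv) is rearranged to avoid
    subtraction.\<close>
  have "r (\<beta> z) (l (\<beta> x) (\<phi> v)) + r (\<beta> z) (r (\<alpha> x) (\<psi> v)) =
        r (\<alpha> x \<cdot> z) (\<phi> (\<psi> v)) + l (\<alpha> (\<beta> x)) (r z (\<phi> v))" for x v
    using mixed_left[of z x v] by (simp add: algebra_simps)
  \<comment> \<open>The terms in \<open>u\<close> are those in \<open>v\<close> with
    \<open>x\<close> and \<open>y\<close> exchanged, and the terms in \<open>w\<close> are the
    polarized identity for \<open>l\<close>. The three relations are added because the goal contains
    all these terms in a single sum.\<close>
  note vanishing = arg_cong2[where f = "(+)",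
      OF arg_cong2[where f = "(+)", OF this[of x v] this[of y u]] l_alternative_polarized[of x y w]]
  show ?thesis
    using A.left_alternative[of x y z] vanishing
    by (simp add: bihom_associator_def ext_mul_simp left_cocycle_def add_simps
        psi_phi[symmetric] beta_alpha[symmetric]) (simp add: algebra_simps)
qed

lemma ext_right_alternator:
  "ext_assoc (x, u) (map_prod \<beta> \<psi> (y, v)) (map_prod \<alpha> \<phi> (z, w)) +
   ext_assoc (x, u) (map_prod \<beta> \<psi> (z, w)) (map_prod \<alpha> \<phi> (y, v)) = (0, right_cocycle x y z)"
proof -
  \<comment> \<open>Now \<open>v\<close> sits in the middle slot of one associator and in the last
    slot of the other, so axiom (v) takes over. The first slot \<open>u\<close> is fixed by the
    exchange and is left to the polarized identity for \<open>r\<close>.\<close>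
  have "l (\<alpha> x) (r (\<alpha> z) (\<psi> v)) + l (\<alpha> x) (l (\<beta> z) (\<phi> v)) =
        l (x \<cdot> \<beta> z) (\<phi> (\<psi> v)) + r (\<alpha> (\<beta> z)) (l x (\<psi> v))" for z v
    using mixed_right[of x z v] by (simp add: algebra_simps)
  note vanishing = arg_cong2[where f = "(+)",
      OF arg_cong2[where f = "(+)", OF this[of z v] this[of y w]] r_alternative_polarized[of y z u]]
  show ?thesis
    using A.right_alternative[of x y z] vanishing
    by (simp add: bihom_associator_def ext_mul_simp right_cocycle_def add_simps
        psi_phi beta_alpha) (simp add: algebra_simps)
qed

lemma ext_bihom_alternative_iff:
  "bihom_alternative_algebra (module_prod.scale scaleA scaleV) (\<circ>\<^sub>\<theta>) (map_prod \<alpha> \<phi>) (map_prod \<beta> \<psi>)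
   \<longleftrightarrow>
     (\<forall>x y. \<phi> (\<theta> x y) = \<theta> (\<alpha> x) (\<alpha> y) \<and> \<psi> (\<theta> x y) = \<theta> (\<beta> x) (\<beta> y)) \<and>
     (\<forall>x y z. left_cocycle x y z = 0) \<and> (\<forall>x y z. right_cocycle x y z = 0)"
  \<comment> \<open>Splitting the quantified pairs exposes the shape that the four component lemmas
    rewrite. Their results are free of \<open>u\<close>, \<open>v\<close> and \<open>w\<close>, so
    only quantifiers over the algebra matter. The remaining axioms hold by the facts supplied
    next.\<close>
  unfolding bihom_alternative_algebra_def bihom_alternative_algebra_axioms_def split_paired_All
    map_prod_alpha_mul_iff map_prod_beta_mul_iff ext_left_alternator ext_right_alternator
  using prod.p.vector_space_axioms ext_mul_bilinear map_prod_linear map_prod_commute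
  by (auto simp: zero_prod_def)

end

theorem proposition4p1:
  fixes scaleA :: "'k::field_char_0 \<Rightarrow> 'a::ab_group_add \<Rightarrow> 'a"
    and mul :: "'a \<Rightarrow> 'a \<Rightarrow> 'a" (infixl "\<cdot>" 70)
    and \<alpha> \<beta> :: "'a \<Rightarrow> 'a"
    and scaleV :: "'k \<Rightarrow> 'v::ab_group_add \<Rightarrow> 'v"
    and l r :: "'a \<Rightarrow> 'v \<Rightarrow> 'v"
    and \<phi> \<psi> :: "'v \<Rightarrow> 'v"
    and \<theta> :: "'a \<Rightarrow> 'a \<Rightarrow> 'v"
  assumes "bihom_alternative_algebra scaleA (\<cdot>) \<alpha> \<beta>"
    and "bihom_alternative_bimodule scaleA (\<cdot>) \<alpha> \<beta> scaleV l r \<phi> \<psi>"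
    and "bilinear_map scaleA scaleA scaleV \<theta>"
  shows "bihom_alternative_algebra (module_prod.scale scaleA scaleV)
           (extension_mul (\<cdot>) l r \<theta>) (map_prod \<alpha> \<phi>) (map_prod \<beta> \<psi>)
    \<longleftrightarrow>
      (\<forall>x y. \<phi> (\<theta> x y) = \<theta> (\<alpha> x) (\<alpha> y) \<and> \<psi> (\<theta> x y) = \<theta> (\<beta> x) (\<beta> y)) \<and>
      (\<forall>x y z.
          \<theta> (\<beta> x \<cdot> \<alpha> y) (\<beta> z) + r (\<beta> z) (\<theta> (\<beta> x) (\<alpha> y))
        - \<theta> (\<alpha> (\<beta> x)) (\<alpha> y \<cdot> z) - l (\<alpha> (\<beta> x)) (\<theta> (\<alpha> y) z)
        + \<theta> (\<beta> y \<cdot> \<alpha> x) (\<beta> z) + r (\<beta> z) (\<theta> (\<beta> y) (\<alpha> x))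
        - \<theta> (\<alpha> (\<beta> y)) (\<alpha> x \<cdot> z) - l (\<alpha> (\<beta> y)) (\<theta> (\<alpha> x) z) = 0) \<and>
      (\<forall>x y z.
          \<theta> (x \<cdot> \<beta> y) (\<alpha> (\<beta> z)) + r (\<alpha> (\<beta> z)) (\<theta> x (\<beta> y))
        - \<theta> (\<alpha> x) (\<beta> y \<cdot> \<alpha> z) - l (\<alpha> x) (\<theta> (\<beta> y) (\<alpha> z))
        + \<theta> (x \<cdot> \<beta> z) (\<alpha> (\<beta> y)) + r (\<alpha> (\<beta> y)) (\<theta> x (\<beta> z))
        - \<theta> (\<alpha> x) (\<beta> z \<cdot> \<alpha> y) - l (\<alpha> x) (\<theta> (\<beta> z) (\<alpha> y)) = 0)"
proof -
  interpret bihom_alternative_extension scaleA mul \<alpha> \<beta> scaleV l r \<phi> \<psi> \<theta>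
    using assms(2,3)
    by (simp add: bihom_alternative_extension_def bihom_alternative_extension_axioms_def)
  show ?thesis
    using ext_bihom_alternative_iff unfolding left_cocycle_def right_cocycle_def .
qed

end
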